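(* Let $(\mathbb{R}^{n},g)$ be the standard pseudo-Euclidean space, $n\geq 2$, with Cartesian coordinates $x=(x_1,\dots,x_n)$ and $g_{ij}=\delta_{ij}\varepsilon_i$, $\varepsilon_i=\pm1$. Let $\Omega\subseteq\mathbb{R}^n$ be an open subset, let $m\in(0,+\infty)$, and let $\xi:\Omega\to\mathbb{R}$ be of the form $$\xi=P\left(\sum_{k=1}^{n}a\varepsilon_kx_k^2+b_kx_k+c_k\right),$$ where $a,b_k,c_k\in\mathbb{R}$ and $P$ is at least a $C^1$ function. Consider non-constant smooth functions $h(\xi),\varphi(\xi),\lambda(\xi):\Omega\to\mathbb{R}$. Then, for any function $\varphi(\xi)$, the manifold with metric $\bar g=\frac{1}{\varphi^2}g$ is a generalized $m$-quasi-Einstein manifold (with potential function $h$ and function $\lambda$) if, and only if, the function $h$ is the solution of the ordinary differential equation $$(n-2)h\varphi''-m\varphi h''-2m\varphi'h'=0,$$ where the function $\lambda$ is given by $$\lambda=2a\varphi\left[(n-2)\varphi'-m\varphi\frac{h'}{h}\right]+\left[\varphi\varphi''-(n-1)(\varphi')^2+m\varphi\varphi'\frac{h'}{h}\right](4a\xi+S)+2na\varphi\varphi'.$$ Here $S=\sum_{k=1}^{n}(\varepsilon_kb_k^2-4ac_k)$.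
   Context: The manifold $(\Omega,\bar g)$ is generalized $m$-quasi-Einstein with potential function $h$ and function $\lambda$ if $Ric_{\bar g}-\frac{m}{h}Hess_{\bar g}(h)=\lambda\,\bar g$, where $Ric_{\bar g}$ and $Hess_{\bar g}(h)$ denote the Ricci tensor and the Hessian of $h$ with respect to $\bar g$; $\varphi$ and $h$ are nowhere zero so that these expressions make sense. The notation $h(\xi)$ means $h\circ\xi$ with $h$ a real function of one real variable, and similarly for $\varphi(\xi)$ and $\lambda(\xi)$. Primes denote derivatives with respect to $\xi$.
   Formalization: For P other than the identity the printed formulas fail; here primes, and the ξ in 4aξ+S, refer to the argument s=Σ(aε_k x_k²+b_k x_k+c_k) of P, with h, φ, λ read as functions of s via P, smooth on an open set containing the values of s. *)

theory Defs
  imports "HOL-Analysis.Analysis"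
begin

text \<open>
  A pseudo-Riemannian metric on an open subset of \<^typ>\<open>real^'n\<close> is given by its matrix of
  components in the Cartesian coordinates. Tensors are likewise given by their components in the
  coordinate frame. All of the operators below only depend on the germ of the metric and of the
  function at the point of evaluation.
\<close>

definition partial :: "'n::finite \<Rightarrow> (real^'n \<Rightarrow> real) \<Rightarrow> real^'n \<Rightarrow> real" where
  "partial i f x = frechet_derivative f (at x) (axis i 1)"

definition christoffel ::
  "(real^'n::finite \<Rightarrow> real^'n^'n) \<Rightarrow> 'n \<Rightarrow> 'n \<Rightarrow> 'n \<Rightarrow> real^'n \<Rightarrow> real" where
  "christoffel g k i j x =
     (\<Sum>l\<in>UNIV. 1 / 2 * matrix_inv (g x) $ k $ l *
        (partial i (\<lambda>y. g y $ j $ l) x + partial j (\<lambda>y. g y $ i $ l) x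
         - partial l (\<lambda>y. g y $ i $ j) x))"

text \<open>
  \<open>riemann g l k i j\<close> is the \<open>l\<close>-th component of \<open>R(e\<^sub>i, e\<^sub>j) e\<^sub>k\<close>, where
  \<open>R(X, Y) Z = D\<^sub>X D\<^sub>Y Z - D\<^sub>Y D\<^sub>X Z - D\<^bsub>[X, Y]\<^esub> Z\<close> and \<open>D\<close> is the Levi-Civita connection. The
  Ricci tensor is the trace of \<open>X \<mapsto> R(X, Y) Z\<close>; with this sign it is positive on round spheres.
\<close>

definition riemann ::
  "(real^'n::finite \<Rightarrow> real^'n^'n) \<Rightarrow> 'n \<Rightarrow> 'n \<Rightarrow> 'n \<Rightarrow> 'n \<Rightarrow> real^'n \<Rightarrow> real" where
  "riemann g l k i j x =
     partial i (christoffel g l j k) x - partial j (christoffel g l i k) x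
     + (\<Sum>p\<in>UNIV. christoffel g l i p x * christoffel g p j k x
                - christoffel g l j p x * christoffel g p i k x)"

definition ricci :: "(real^'n::finite \<Rightarrow> real^'n^'n) \<Rightarrow> real^'n \<Rightarrow> real^'n^'n" where
  "ricci g x = (\<chi> j k. \<Sum>i\<in>UNIV. riemann g i k i j x)"

definition hess ::
  "(real^'n::finite \<Rightarrow> real^'n^'n) \<Rightarrow> (real^'n \<Rightarrow> real) \<Rightarrow> real^'n \<Rightarrow> real^'n^'n" where
  "hess g f x =
     (\<chi> i j. partial i (partial j f) x - (\<Sum>k\<in>UNIV. christoffel g k i j x * partial k f x))"

definition generalized_quasi_Einstein ::
  "(real^'n::finite) set \<Rightarrow> (real^'n \<Rightarrow> real^'n^'n) \<Rightarrow> real \<Rightarrow> (real^'n \<Rightarrow> real) \<Rightarrow>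
     (real^'n \<Rightarrow> real) \<Rightarrow> bool" where
  "generalized_quasi_Einstein \<Omega> g m h lam \<longleftrightarrow>
     (\<forall>x\<in>\<Omega>. ricci g x - (m / h x) *\<^sub>R hess g h x = lam x *\<^sub>R g x)"

definition pseudo_euclidean :: "('n::finite \<Rightarrow> real) \<Rightarrow> real^'n^'n" where
  "pseudo_euclidean \<epsilon> = (\<chi> i j. if i = j then \<epsilon> i else 0)"

definition smooth_on :: "real set \<Rightarrow> (real \<Rightarrow> real) \<Rightarrow> bool" where
  "smooth_on U f \<longleftrightarrow> (\<forall>k. \<forall>t\<in>U. ((deriv ^^ k) f) field_differentiable (at t))"

text \<open>
  The argument of \<open>P\<close> in \<open>\<xi> = P (\<Sum>\<^sub>k a \<epsilon>\<^sub>k x\<^sub>k\<^sup>2 + b\<^sub>k x\<^sub>k + c\<^sub>k)\<close>. It is the variable with respect to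
  which functions of \<open>\<xi>\<close> are differentiated: the formula
  \<open>\<Sum>\<^sub>k \<epsilon>\<^sub>k (\<partial>\<^sub>k s)\<^sup>2 = 4 a s + S\<close> holds for this \<open>s\<close>, but not for \<open>P s\<close> when \<open>P\<close> is arbitrary.
\<close>

definition basic_invariant ::
  "real \<Rightarrow> ('n::finite \<Rightarrow> real) \<Rightarrow> ('n \<Rightarrow> real) \<Rightarrow> ('n \<Rightarrow> real) \<Rightarrow> real^'n \<Rightarrow> real" where
  "basic_invariant a \<epsilon> b c x = (\<Sum>k\<in>UNIV. a * \<epsilon> k * (x $ k)\<^sup>2 + b k * x $ k + c k)"

end

theory Submission
  imports Defs
begin

text \<open>
  For \<open>f = \<phi>(\<xi>)\<close>, the metric \<open>f\<^sup>-\<^sup>2 g\<close> has Christoffel symbols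
  \<open>\<delta>\<^sub>j\<^sub>k w\<^sub>i + \<delta>\<^sub>i\<^sub>k w\<^sub>j - \<epsilon>\<^sub>i \<epsilon>\<^sub>k \<delta>\<^sub>i\<^sub>j w\<^sub>k\<close> with \<open>w = - df / f\<close>, which yields the conformal formulas for Ricci
  tensor and Hessian. For functions of the quadratic invariant \<open>s\<close>, with gradient
  \<open>\<sigma>\<^sub>i = 2 a \<epsilon>\<^sub>i x\<^sub>i + b\<^sub>i\<close>, the quasi-Einstein equation at a point becomes
  \<open>K \<sigma>\<^sub>i \<sigma>\<^sub>j = \<delta>\<^sub>i\<^sub>j \<epsilon>\<^sub>i D\<close>, where \<open>K\<close> is a nonzero multiple of the left side of the differential equation
  and \<open>D\<close> is the difference of the two sides of the formula for \<open>\<lambda>\<close>. As \<open>n \<ge> 2\<close>, this forces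
  \<open>D = 0\<close>, and \<open>K = 0\<close> wherever \<open>\<sigma> \<noteq> 0\<close>. A zero of \<open>\<sigma>\<close> is isolated unless \<open>s\<close> is constant, so \<open>K = 0\<close>
  there by continuity.
\<close>

section \<open>Partial derivatives as components of the Frechet derivative\<close>

lemma partial_eq:
  assumes "(f has_derivative D) (at x)"
  shows "partial i f x = D (axis i 1)"
  unfolding partial_def using frechet_derivative_at[OF assms] by simp

text \<open>\<open>frechet_derivative\<close> is a choice among the derivatives at a point.
  Functions that agree near \<open>x\<close> have the same derivatives there, so the choices
  coincide, even where no derivative exists.\<close>

lemma partial_cong_open:
  assumes "open \<Omega>" "x \<in> \<Omega>" "\<And>y. y \<in> \<Omega> \<Longrightarrow> f y = g y"
  shows "partial i f x = partial i g x"
proof -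
  have "(f has_derivative D) (at x) \<longleftrightarrow> (g has_derivative D) (at x)" for D
    using assms has_derivative_transform_within_open[of _ D x UNIV \<Omega>] by metis
  then show ?thesis
    by (simp add: partial_def frechet_derivative_def)
qed

lemma has_derivative_partial:
  assumes "f differentiable (at x)"
  shows "(f has_derivative (\<lambda>v. \<Sum>i\<in>UNIV. v $ i * partial i f x)) (at x)"
proof -
  let ?D = "frechet_derivative f (at x)"
  have D: "(f has_derivative ?D) (at x)"
    using assms frechet_derivative_works by blast
  then interpret linear ?D
    using has_derivative_linear by blast
  have "?D v = (\<Sum>i\<in>UNIV. v $ i * partial i f x)" for v
  proof -
    have "?D v = ?D (\<Sum>i\<in>UNIV. v $ i *\<^sub>R axis i 1)"
      by (metis basis_expansion scalar_mult_eq_scaleR)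
    then show ?thesis
      by (simp add: sum scale partial_def)
  qed
  then have "?D = (\<lambda>v. \<Sum>i\<in>UNIV. v $ i * partial i f x)"
    by blast
  then show ?thesis
    using D by simp
qed

text \<open>Evaluates a derivative written as \<open>\<Sum>k. v $ k * p k\<close> at a basis vector,
  the form in which \<open>partial_eq\<close> is applied below.\<close>

lemma partial_sum_axis [simp]:
  fixes p :: "'n::finite \<Rightarrow> real"
  shows "(\<Sum>k\<in>UNIV. axis i 1 $ k * p k) = p i"
  by (simp add: axis_def if_distrib [of "\<lambda>z. z * _"] cong: if_cong)

text \<open>\<open>matrix_inv\<close> is a choice too: \<open>B\<close> witnesses that the chosen
  matrix is a right inverse of \<open>A\<close>, and multiplying by \<open>B\<close> from the left
  identifies the two.\<close>

lemma matrix_inv_unique: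
  assumes "A ** B = mat 1" "B ** A = mat 1"
  shows "matrix_inv A = B"
proof -
  have "A ** matrix_inv A = mat 1"
    unfolding matrix_inv_def
    by (rule someI2 [where a = B and Q = "\<lambda>C. A ** C = mat 1"]) (use assms in auto)
  then show ?thesis
    by (metis assms(2) matrix_mul_assoc matrix_mul_lid matrix_mul_rid)
qed

lemma matrix_inv_scaled_pseudo_euclidean:
  fixes \<epsilon> :: "'n::finite \<Rightarrow> real"
  assumes "\<And>k. \<epsilon> k = 1 \<or> \<epsilon> k = -1" "r \<noteq> 0"
  shows "matrix_inv (r *\<^sub>R pseudo_euclidean \<epsilon>) = (1 / r) *\<^sub>R pseudo_euclidean \<epsilon>"
proof -
  have "\<epsilon> k * \<epsilon> k = 1" for k
    using assms(1)[of k] by auto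
  then have "pseudo_euclidean \<epsilon> ** pseudo_euclidean \<epsilon> = mat 1"
    by (simp add: vec_eq_iff matrix_matrix_mult_def mat_def pseudo_euclidean_def
        if_distrib [of "\<lambda>z. z * _"] if_distrib [of "\<lambda>z. _ * z"] cong: if_cong)
  then show ?thesis
    using assms(2) by (intro matrix_inv_unique) (simp_all add: matrix_scalar_ac scalar_matrix_assoc)
qed

section \<open>Levi-Civita connection of a conformally flat metric\<close>

text \<open>These are the Christoffel symbols of \<open>exp (2 * u)\<close> times the flat metric
  when \<open>w\<close> is the differential of \<open>u\<close>; here \<open>u\<close> is minus the
  logarithm of \<open>\<bar>f\<bar>\<close>. The covector is a parameter because the expression is
  linear in it: differentiating the symbols amounts to replacing \<open>w\<close> by its
  derivative.\<close>

definition conformal_connection ::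
  "('n \<Rightarrow> real) \<Rightarrow> ('n \<Rightarrow> real) \<Rightarrow> 'n \<Rightarrow> 'n \<Rightarrow> 'n \<Rightarrow> real" where
  "conformal_connection \<epsilon> w k i j =
     (if j = k then w i else 0) + (if i = k then w j else 0)
     - (if i = j then \<epsilon> i * \<epsilon> k * w k else 0)"

lemma partial_conformal_metric:
  fixes \<epsilon> :: "'n::finite \<Rightarrow> real"
  assumes "f differentiable (at x)" "f x \<noteq> 0"
  shows "partial i (\<lambda>y. ((1 / (f y)\<^sup>2) *\<^sub>R pseudo_euclidean \<epsilon>) $ j $ l) x =
    (if j = l then - 2 * \<epsilon> j * partial i f x / f x ^ 3 else 0)"
proof -
  have "((\<lambda>y. ((1 / (f y)\<^sup>2) *\<^sub>R pseudo_euclidean \<epsilon>) $ j $ l) has_derivative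
      (\<lambda>v. (if j = l then - 2 * \<epsilon> j / f x ^ 3 else 0) * (\<Sum>i\<in>UNIV. v $ i * partial i f x))) (at x)"
    using assms(2)
    by (auto simp: pseudo_euclidean_def power2_eq_square power3_eq_cube field_simps
        intro!: derivative_eq_intros has_derivative_partial[OF assms(1)])
  from partial_eq[OF this, of i] show ?thesis
    by simp
qed

text \<open>The inverse metric is diagonal, so the sum over \<open>l\<close> reduces to
  \<open>l = k\<close>. Its factor \<open>(f x)\<^sup>2\<close> turns \<open>-2 / f x ^ 3\<close>
  into \<open>-2 / f x\<close>, and \<open>\<epsilon> k * \<epsilon> k = 1\<close> removes the
  signs.\<close>

lemma christoffel_conformal:
  fixes \<epsilon> :: "'n::finite \<Rightarrow> real"
  assumes eps: "\<And>k. \<epsilon> k = 1 \<or> \<epsilon> k = -1"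
    and "f differentiable (at x)" "f x \<noteq> 0"
  shows "christoffel (\<lambda>y. (1 / (f y)\<^sup>2) *\<^sub>R pseudo_euclidean \<epsilon>) k i j x =
    conformal_connection \<epsilon> (\<lambda>l. - partial l f x / f x) k i j"
proof -
  have [simp]: "\<epsilon> k * \<epsilon> k = 1" "\<epsilon> k * (\<epsilon> k * r) = r" for k r
    using eps[of k] by auto
  have "christoffel (\<lambda>y. (1 / (f y)\<^sup>2) *\<^sub>R pseudo_euclidean \<epsilon>) k i j x =
     1 / 2 * ((f x)\<^sup>2 * \<epsilon> k) *
       ((if j = k then - 2 * \<epsilon> j * partial i f x / f x ^ 3 else 0)
       + (if i = k then - 2 * \<epsilon> i * partial j f x / f x ^ 3 else 0)
       - (if i = j then - 2 * \<epsilon> i * partial k f x / f x ^ 3 else 0))"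
    unfolding christoffel_def partial_conformal_metric[OF assms(2,3)] using assms(3)
    by (subst matrix_inv_scaled_pseudo_euclidean[OF eps])
      (simp_all add: pseudo_euclidean_def if_distrib [of "\<lambda>z. z * _"] if_distrib [of "\<lambda>z. _ * z"]
        cong: if_cong)
  also have "\<dots> = conformal_connection \<epsilon> (\<lambda>l. - partial l f x / f x) k i j"
    using assms(3)
    by (auto simp: conformal_connection_def power2_eq_square power3_eq_cube field_simps)
  finally show ?thesis .
qed

lemma sum_conformal_connection:
  fixes \<epsilon> w p :: "'n::finite \<Rightarrow> real"
  shows "(\<Sum>k\<in>UNIV. conformal_connection \<epsilon> w k i j * p k) =
    w i * p j + w j * p i - (if i = j then \<epsilon> i * (\<Sum>k\<in>UNIV. \<epsilon> k * w k * p k) else 0)"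
  by (simp add: conformal_connection_def algebra_simps sum.distrib sum_subtractf sum_distrib_left
      if_distrib [of "\<lambda>z. z * _"] if_distrib [of "\<lambda>z. _ * z"] cong: if_cong)

text \<open>The first and the last term of the connection cancel in the trace. This is the
  differential of the logarithm of the volume density.\<close>

lemma conformal_connection_trace:
  fixes \<epsilon> w :: "'n::finite \<Rightarrow> real"
  assumes eps: "\<And>k. \<epsilon> k = 1 \<or> \<epsilon> k = -1"
  shows "(\<Sum>i\<in>UNIV. conformal_connection \<epsilon> w i i p) = real CARD('n) * w p"
proof -
  have [simp]: "\<epsilon> k * \<epsilon> k = 1" "\<epsilon> k * (\<epsilon> k * r) = r" for k r
    using eps[of k] by auto
  show ?thesis
    by (simp add: conformal_connection_def sum.distrib sum_subtractf cong: if_cong)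
qed

text \<open>With \<open>W i l\<close> as the \<open>i\<close>-th derivative of the
  \<open>l\<close>-th component of \<open>w\<close>, this is the divergence term of the Ricci
  tensor.\<close>

lemma conformal_connection_divergence:
  fixes \<epsilon> :: "'n::finite \<Rightarrow> real" and W :: "'n \<Rightarrow> 'n \<Rightarrow> real"
  shows "(\<Sum>i\<in>UNIV. conformal_connection \<epsilon> (W i) i j k) =
    W k j + W j k - (if j = k then \<epsilon> j * (\<Sum>i\<in>UNIV. \<epsilon> i * W i i) else 0)"
  by (simp add: conformal_connection_def sum.distrib sum_subtractf sum_distrib_left algebra_simps
      cong: if_cong)

text \<open>Only the first factor is expanded. Each of its three deltas removes one summation,
  leaving a trace, a contraction with \<open>w\<close>, and a sum in which the products
  \<open>w j * w k\<close> cancel.\<close>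

lemma conformal_connection_quadratic:
  fixes \<epsilon> w :: "'n::finite \<Rightarrow> real"
  assumes eps: "\<And>k. \<epsilon> k = 1 \<or> \<epsilon> k = -1"
  shows "(\<Sum>i\<in>UNIV. \<Sum>p\<in>UNIV. conformal_connection \<epsilon> w i j p * conformal_connection \<epsilon> w p i k) =
    (real CARD('n) + 2) * w j * w k - (if j = k then 2 * \<epsilon> j * (\<Sum>i\<in>UNIV. \<epsilon> i * (w i)\<^sup>2) else 0)"
proof -
  have [simp]: "\<epsilon> k * \<epsilon> k = 1" "\<epsilon> k * (\<epsilon> k * r) = r" for k r
    using eps[of k] by auto
  have "(\<Sum>p\<in>UNIV. conformal_connection \<epsilon> w i j p * conformal_connection \<epsilon> w p i k) =
      conformal_connection \<epsilon> w i i k * w j + (if i = j then \<Sum>p\<in>UNIV. conformal_connection \<epsilon> w p i k * w p else 0)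
      - conformal_connection \<epsilon> w j i k * (\<epsilon> i * \<epsilon> j * w i)" for i
    by (subst (1) conformal_connection_def)
      (auto simp: algebra_simps sum.distrib sum_subtractf
      if_distrib [of "\<lambda>z. z * _"] if_distrib [of "\<lambda>z. _ * z"] cong: if_cong)
  moreover have "(\<Sum>i\<in>UNIV. conformal_connection \<epsilon> w j i k * (\<epsilon> i * \<epsilon> j * w i)) =
     (if j = k then \<epsilon> j * (\<Sum>i\<in>UNIV. \<epsilon> i * (w i)\<^sup>2) else 0)"
    by (auto simp: conformal_connection_def algebra_simps sum.distrib sum_subtractf sum_distrib_left
      power2_eq_square if_distrib [of "\<lambda>z. z * _"] if_distrib [of "\<lambda>z. _ * z"] cong: if_cong)
  moreover have "(\<Sum>p\<in>UNIV. conformal_connection \<epsilon> w p j k * w p) =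
     2 * w j * w k - (if j = k then \<epsilon> j * (\<Sum>i\<in>UNIV. \<epsilon> i * (w i)\<^sup>2) else 0)"
    by (simp add: sum_conformal_connection power2_eq_square mult.assoc)
  ultimately show ?thesis
    by (simp add: sum.distrib sum_subtractf sum_distrib_right[symmetric]
        conformal_connection_trace[OF eps] cong: if_cong) (simp add: algebra_simps)
qed

section \<open>Ricci tensor and Hessian under a conformal change\<close>

text \<open>The factor \<open>(f x)\<^sup>2\<close> clears the denominators. Symmetry of the second
  derivatives is assumed as \<open>sym\<close> because it can be read off the explicit formula for
  functions of the quadratic invariant.\<close>

lemma ricci_conformal:
  fixes \<epsilon> :: "'n::finite \<Rightarrow> real"
  assumes eps: "\<And>k. \<epsilon> k = 1 \<or> \<epsilon> k = -1"
    and \<Omega>: "open \<Omega>" "x \<in> \<Omega>"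
    and f: "\<And>y. y \<in> \<Omega> \<Longrightarrow> f differentiable (at y)" "\<And>y. y \<in> \<Omega> \<Longrightarrow> f y \<noteq> 0"
    and f': "\<And>k. partial k f differentiable (at x)"
    and sym: "\<And>i j. partial i (partial j f) x = partial j (partial i f) x"
  shows "(f x)\<^sup>2 * ricci (\<lambda>y. (1 / (f y)\<^sup>2) *\<^sub>R pseudo_euclidean \<epsilon>) x $ j $ k =
    (real CARD('n) - 2) * f x * partial j (partial k f) x
    + (if j = k then \<epsilon> j * (f x * (\<Sum>i\<in>UNIV. \<epsilon> i * partial i (partial i f) x)
        - (real CARD('n) - 1) * (\<Sum>i\<in>UNIV. \<epsilon> i * (partial i f x)\<^sup>2)) else 0)"
proof -
  let ?g = "\<lambda>y. (1 / (f y)\<^sup>2) *\<^sub>R pseudo_euclidean \<epsilon>"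
  define w where "w y l = - partial l f y / f y" for y l
  define W where "W i l = - partial i (partial l f) x / f x + partial i f x * partial l f x / (f x)\<^sup>2"
    for i l
  have fx: "f x \<noteq> 0" "f differentiable (at x)"
    using f \<Omega> by auto
  have chr: "christoffel ?g l i j y = conformal_connection \<epsilon> (w y) l i j" if "y \<in> \<Omega>" for l i j y
    using christoffel_conformal[OF eps f(1)[OF that] f(2)[OF that]] by (simp add: w_def [abs_def])
  have dw: "((\<lambda>y. w y l) has_derivative (\<lambda>v. \<Sum>i\<in>UNIV. v $ i * W i l)) (at x)" for l
  proof -
    have "((\<lambda>y. w y l) has_derivative (\<lambda>v. - (\<Sum>i\<in>UNIV. v $ i * partial i (partial l f) x) / f x
        + partial l f x * (\<Sum>i\<in>UNIV. v $ i * partial i f x) / (f x)\<^sup>2)) (at x)"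
      unfolding w_def using fx
      by (auto intro!: derivative_eq_intros has_derivative_partial f'
          simp: field_simps power2_eq_square)
    also have "(\<lambda>v. - (\<Sum>i\<in>UNIV. v $ i * partial i (partial l f) x) / f x
        + partial l f x * (\<Sum>i\<in>UNIV. v $ i * partial i f x) / (f x)\<^sup>2) =
        (\<lambda>v. \<Sum>i\<in>UNIV. v $ i * W i l)"
      by (simp add: W_def sum_distrib_left sum_divide_distrib sum_subtractf algebra_simps)
    finally show ?thesis .
  qed
  have dw_if: "((\<lambda>y. if A then w y l else 0) has_derivative
      (\<lambda>v. if A then \<Sum>i\<in>UNIV. v $ i * W i l else 0)) (at x)"
    "((\<lambda>y. if A then r * w y l else 0) has_derivative
      (\<lambda>v. if A then r * (\<Sum>i\<in>UNIV. v $ i * W i l) else 0)) (at x)" for A r l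
    by (cases A; simp; intro dw has_derivative_mult_right)+
  \<comment> \<open>The closed form of the symbols is known on all of \<Omega>, hence near
    \<open>x\<close>, so it may be differentiated in their place.\<close>
  have dchr: "partial p (christoffel ?g l i j) x = conformal_connection \<epsilon> (W p) l i j" for p l i j
  proof -
    have "((\<lambda>y. conformal_connection \<epsilon> (w y) l i j) has_derivative
      (\<lambda>v. (if j = l then \<Sum>p\<in>UNIV. v $ p * W p i else 0)
        + (if i = l then \<Sum>p\<in>UNIV. v $ p * W p j else 0)
        - (if i = j then \<epsilon> i * \<epsilon> l * (\<Sum>p\<in>UNIV. v $ p * W p l) else 0))) (at x)"
      unfolding conformal_connection_def
      by (intro has_derivative_add has_derivative_diff dw_if)
    from partial_eq[OF this, of p] show ?thesis
      using partial_cong_open[OF \<Omega> chr] by (simp add: conformal_connection_def)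
  qed
  have Wsym: "W i l = W l i" for i l
    by (simp add: W_def sym)
  \<comment> \<open>The four sums are the divergence, the derivative of the trace, the trace
    contracted with the connection, and the quadratic term.\<close>
  have "ricci ?g x $ j $ k =
      (\<Sum>i\<in>UNIV. conformal_connection \<epsilon> (W i) i j k)
      - (\<Sum>i\<in>UNIV. conformal_connection \<epsilon> (W j) i i k)
      + (\<Sum>p\<in>UNIV. (\<Sum>i\<in>UNIV. conformal_connection \<epsilon> (w x) i i p) * conformal_connection \<epsilon> (w x) p j k)
      - (\<Sum>i\<in>UNIV. \<Sum>p\<in>UNIV. conformal_connection \<epsilon> (w x) i j p * conformal_connection \<epsilon> (w x) p i k)"
    unfolding sum_distrib_right
    using sum.swap[of "\<lambda>i p. conformal_connection \<epsilon> (w x) i i p * conformal_connection \<epsilon> (w x) p j k"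
        UNIV UNIV]
    by (simp add: ricci_def riemann_def dchr chr[OF \<Omega>(2)] sum.distrib sum_subtractf)
  also have "(\<Sum>p\<in>UNIV. (\<Sum>i\<in>UNIV. conformal_connection \<epsilon> (w x) i i p) * conformal_connection \<epsilon> (w x) p j k) =
      real CARD('n) * (\<Sum>p\<in>UNIV. conformal_connection \<epsilon> (w x) p j k * w x p)"
    unfolding conformal_connection_trace[OF eps] sum_distrib_left by (simp add: mult_ac)
  finally have "ricci ?g x $ j $ k = W k j + W j k - (if j = k then \<epsilon> j * (\<Sum>i\<in>UNIV. \<epsilon> i * W i i) else 0)
      - real CARD('n) * W j k
      + real CARD('n) * (2 * w x j * w x k - (if j = k then \<epsilon> j * (\<Sum>p\<in>UNIV. \<epsilon> p * (w x p)\<^sup>2) else 0))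
      - ((real CARD('n) + 2) * w x j * w x k
         - (if j = k then 2 * \<epsilon> j * (\<Sum>i\<in>UNIV. \<epsilon> i * (w x i)\<^sup>2) else 0))"
    unfolding conformal_connection_trace[OF eps] conformal_connection_divergence
      conformal_connection_quadratic[OF eps] sum_conformal_connection
    by (simp add: power2_eq_square mult.assoc)
  \<comment> \<open>This is the classical formula: \<open>w\<close> is the differential of the
    conformal exponent and \<open>W\<close> its flat Hessian, which \<open>sym\<close> makes
    symmetric.\<close>
  also have "\<dots> = - (real CARD('n) - 2) * (W j k - w x j * w x k)
      - (if j = k then \<epsilon> j * ((\<Sum>i\<in>UNIV. \<epsilon> i * W i i)
          + (real CARD('n) - 2) * (\<Sum>i\<in>UNIV. \<epsilon> i * (w x i)\<^sup>2)) else 0)"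
    by (simp add: Wsym[of k j] algebra_simps)
  also have "(\<Sum>i\<in>UNIV. \<epsilon> i * (w x i)\<^sup>2) = (\<Sum>i\<in>UNIV. \<epsilon> i * (partial i f x)\<^sup>2) / (f x)\<^sup>2"
    by (simp add: w_def sum_divide_distrib power_divide)
  also have "(\<Sum>i\<in>UNIV. \<epsilon> i * W i i) = - (\<Sum>i\<in>UNIV. \<epsilon> i * partial i (partial i f) x) / f x
      + (\<Sum>i\<in>UNIV. \<epsilon> i * (partial i f x)\<^sup>2) / (f x)\<^sup>2"
    by (simp add: W_def sum_divide_distrib sum.distrib sum_subtractf algebra_simps power2_eq_square)
  finally have ric: "ricci ?g x $ j $ k = - (real CARD('n) - 2) * (W j k - w x j * w x k)
      - (if j = k then \<epsilon> j * (- (\<Sum>i\<in>UNIV. \<epsilon> i * partial i (partial i f) x) / f x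
          + (\<Sum>i\<in>UNIV. \<epsilon> i * (partial i f x)\<^sup>2) / (f x)\<^sup>2
          + (real CARD('n) - 2) * ((\<Sum>i\<in>UNIV. \<epsilon> i * (partial i f x)\<^sup>2) / (f x)\<^sup>2)) else 0)" .
  \<comment> \<open>In \<open>W j k - w x j * w x k\<close> the products of first derivatives
    cancel, so off the diagonal only second derivatives of \<open>f\<close> survive.\<close>
  show ?thesis
    unfolding ric using fx(1)
    by (cases "j = k") (simp_all add: W_def w_def field_simps power2_eq_square)
qed

lemma hess_conformal:
  fixes \<epsilon> :: "'n::finite \<Rightarrow> real"
  assumes eps: "\<And>k. \<epsilon> k = 1 \<or> \<epsilon> k = -1"
    and "f differentiable (at x)" "f x \<noteq> 0"
  shows "hess (\<lambda>y. (1 / (f y)\<^sup>2) *\<^sub>R pseudo_euclidean \<epsilon>) u x $ i $ j =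
    partial i (partial j u) x + (partial i f x * partial j u x + partial j f x * partial i u x) / f x
    - (if i = j then \<epsilon> i * (\<Sum>k\<in>UNIV. \<epsilon> k * partial k f x * partial k u x) / f x else 0)"
proof -
  have "(\<Sum>k\<in>UNIV. \<epsilon> k * (- partial k f x / f x) * partial k u x) =
      - (\<Sum>k\<in>UNIV. \<epsilon> k * partial k f x * partial k u x) / f x"
    by (simp add: sum_divide_distrib sum_negf)
  then show ?thesis
    unfolding hess_def christoffel_conformal[OF assms] sum_conformal_connection
    using assms(3) by (simp add: field_simps)
qed

section \<open>Functions of the quadratic invariant\<close>

text \<open>These are the cases \<open>k = 0, 1, 2\<close> of smoothness. Continuity of the second
  derivative serves to extend the differential equation to critical points of the invariant.\<close>

lemma smooth_on_imp_has_real_derivative: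
  assumes "smooth_on U F" "t \<in> U"
  shows "(F has_real_derivative deriv F t) (at t)"
    "(deriv F has_real_derivative deriv (deriv F) t) (at t)"
    "isCont (deriv (deriv F)) t"
proof -
  have *: "((deriv ^^ k) F) field_differentiable (at t)" for k
    using assms by (auto simp: smooth_on_def)
  from *[of 0] *[of 1] *[of 2] show "(F has_real_derivative deriv F t) (at t)"
    "(deriv F has_real_derivative deriv (deriv F) t) (at t)"
    "isCont (deriv (deriv F)) t"
    by (simp_all add: field_differentiable_derivI field_differentiable_imp_continuous_at
        numeral_2_eq_2 DERIV_deriv_iff_field_differentiable)
qed

definition grad_invariant ::
  "real \<Rightarrow> ('n::finite \<Rightarrow> real) \<Rightarrow> ('n \<Rightarrow> real) \<Rightarrow> 'n \<Rightarrow> real^'n \<Rightarrow> real" where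
  "grad_invariant a \<epsilon> b i x = 2 * a * \<epsilon> i * x $ i + b i"

lemma has_derivative_basic_invariant:
  "(basic_invariant a \<epsilon> b c has_derivative (\<lambda>v. \<Sum>i\<in>UNIV. v $ i * grad_invariant a \<epsilon> b i x)) (at x)"
  unfolding basic_invariant_def [abs_def] grad_invariant_def
  by (auto intro!: derivative_eq_intros sum.cong
      bounded_linear_imp_has_derivative[OF bounded_linear_vec_nth] simp: algebra_simps)

lemma has_derivative_comp_basic_invariant:
  assumes "(F has_real_derivative D) (at (basic_invariant a \<epsilon> b c x))"
  shows "((\<lambda>y. F (basic_invariant a \<epsilon> b c y)) has_derivative
    (\<lambda>v. D * (\<Sum>i\<in>UNIV. v $ i * grad_invariant a \<epsilon> b i x))) (at x)"
  using has_derivative_compose[OF has_derivative_basic_invariant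
      assms[unfolded has_field_derivative_def]] by simp

lemma partial_comp_basic_invariant:
  assumes "(F has_real_derivative D) (at (basic_invariant a \<epsilon> b c x))"
  shows "partial i (\<lambda>y. F (basic_invariant a \<epsilon> b c y)) x = D * grad_invariant a \<epsilon> b i x"
  using partial_eq[OF has_derivative_comp_basic_invariant[OF assms], of i] by simp

lemma has_derivative_partial_comp_basic_invariant:
  fixes \<epsilon> :: "'n::finite \<Rightarrow> real"
  assumes "smooth_on U F" "open \<Omega>" "x \<in> \<Omega>" "basic_invariant a \<epsilon> b c ` \<Omega> \<subseteq> U"
  defines "t \<equiv> basic_invariant a \<epsilon> b c x"
  shows "(partial j (\<lambda>y. F (basic_invariant a \<epsilon> b c y)) has_derivative
    (\<lambda>v. deriv F t * (2 * a * \<epsilon> j * v $ j) + deriv (deriv F) t *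
       (\<Sum>i\<in>UNIV. v $ i * grad_invariant a \<epsilon> b i x) * grad_invariant a \<epsilon> b j x)) (at x)"
proof (rule has_derivative_transform_within_open[OF _ assms(2,3)])
  show "deriv F (basic_invariant a \<epsilon> b c y) * grad_invariant a \<epsilon> b j y =
      partial j (\<lambda>y. F (basic_invariant a \<epsilon> b c y)) y" if "y \<in> \<Omega>" for y
    using smooth_on_imp_has_real_derivative(1)[OF assms(1)] that assms(4)
    by (subst partial_comp_basic_invariant) auto
  have "(grad_invariant a \<epsilon> b j has_derivative (\<lambda>v. 2 * a * \<epsilon> j * v $ j)) (at x)"
    unfolding grad_invariant_def [abs_def]
    by (auto intro!: derivative_eq_intros bounded_linear_imp_has_derivative[OF bounded_linear_vec_nth])
  moreover have "(deriv F has_real_derivative deriv (deriv F) t) (at t)"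
    using smooth_on_imp_has_real_derivative(2)[OF assms(1)] assms(3,4) by (auto simp: t_def)
  ultimately show "((\<lambda>y. deriv F (basic_invariant a \<epsilon> b c y) * grad_invariant a \<epsilon> b j y)
      has_derivative (\<lambda>v. deriv F t * (2 * a * \<epsilon> j * v $ j) + deriv (deriv F) t *
       (\<Sum>i\<in>UNIV. v $ i * grad_invariant a \<epsilon> b i x) * grad_invariant a \<epsilon> b j x)) (at x)"
    unfolding t_def by (intro has_derivative_mult has_derivative_comp_basic_invariant)
qed

lemma partial_partial_comp_basic_invariant:
  fixes \<epsilon> :: "'n::finite \<Rightarrow> real"
  assumes "smooth_on U F" "open \<Omega>" "x \<in> \<Omega>" "basic_invariant a \<epsilon> b c ` \<Omega> \<subseteq> U"
  defines "t \<equiv> basic_invariant a \<epsilon> b c x"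
  shows "partial i (partial j (\<lambda>y. F (basic_invariant a \<epsilon> b c y))) x =
    deriv (deriv F) t * grad_invariant a \<epsilon> b i x * grad_invariant a \<epsilon> b j x
    + (if i = j then 2 * a * \<epsilon> j * deriv F t else 0)"
  unfolding t_def
  by (subst partial_eq[OF has_derivative_partial_comp_basic_invariant[OF assms(1-4)]])
    (auto simp: axis_def if_distrib [of "\<lambda>z. z * _"] cong: if_cong)

text \<open>Holds term by term after expanding the square, since
  \<open>\<epsilon> k * \<epsilon> k = 1\<close>. It is the source of the factor
  \<open>4 * a * t + S\<close> in the theorem.\<close>

lemma sum_grad_invariant_sq:
  assumes eps: "\<And>k. \<epsilon> k = 1 \<or> \<epsilon> k = -1"
  shows "(\<Sum>k\<in>UNIV. \<epsilon> k * (grad_invariant a \<epsilon> b k x)\<^sup>2) =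
    4 * a * basic_invariant a \<epsilon> b c x + (\<Sum>k\<in>UNIV. \<epsilon> k * (b k)\<^sup>2 - 4 * a * c k)"
proof -
  have "\<epsilon> k * (grad_invariant a \<epsilon> b k x)\<^sup>2 =
      4 * a * (a * \<epsilon> k * (x $ k)\<^sup>2 + b k * x $ k + c k) + (\<epsilon> k * (b k)\<^sup>2 - 4 * a * c k)" for k
    using eps[of k] by (auto simp: grad_invariant_def power2_eq_square algebra_simps)
  then show ?thesis
    by (simp add: basic_invariant_def sum.distrib flip: sum_distrib_left)
qed

text \<open>The flat Hessian of a function of the invariant is a multiple of
  \<open>\<sigma> i * \<sigma> j\<close> plus a multiple of the flat metric. The conformal
  corrections are of the same two types, so the whole tensor splits accordingly.\<close>

lemma quasi_Einstein_tensor_comp_basic_invariant: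
  fixes \<epsilon> b c :: "'n::finite \<Rightarrow> real" and a m :: real and x :: "real^'n"
  defines "s \<equiv> basic_invariant a \<epsilon> b c" and "\<sigma> \<equiv> \<lambda>i. grad_invariant a \<epsilon> b i x"
    and "n \<equiv> real CARD('n)" and "t \<equiv> basic_invariant a \<epsilon> b c x"
  assumes eps: "\<And>k. \<epsilon> k = 1 \<or> \<epsilon> k = -1"
    and \<Omega>: "open \<Omega>" "x \<in> \<Omega>" "s ` \<Omega> \<subseteq> U"
    and smooth: "smooth_on U H" "smooth_on U \<Phi>"
    and nonzero: "\<And>y. y \<in> \<Omega> \<Longrightarrow> H (s y) \<noteq> 0" "\<And>y. y \<in> \<Omega> \<Longrightarrow> \<Phi> (s y) \<noteq> 0"
  shows "(\<Phi> t)\<^sup>2 * (ricci (\<lambda>y. (1 / (\<Phi> (s y))\<^sup>2) *\<^sub>R pseudo_euclidean \<epsilon>) x $ i $ j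
      - m / H t * hess (\<lambda>y. (1 / (\<Phi> (s y))\<^sup>2) *\<^sub>R pseudo_euclidean \<epsilon>) (\<lambda>y. H (s y)) x $ i $ j) =
    \<Phi> t / H t * ((n - 2) * H t * deriv (deriv \<Phi>) t - m * \<Phi> t * deriv (deriv H) t
          - 2 * m * deriv \<Phi> t * deriv H t) * \<sigma> i * \<sigma> j
    + (if i = j then \<epsilon> i * (2 * a * \<Phi> t * ((n - 2) * deriv \<Phi> t - m * \<Phi> t * (deriv H t / H t))
          + (\<Phi> t * deriv (deriv \<Phi>) t - (n - 1) * (deriv \<Phi> t)\<^sup>2
             + m * \<Phi> t * deriv \<Phi> t * (deriv H t / H t))
             * (4 * a * t + (\<Sum>k\<in>UNIV. \<epsilon> k * (b k)\<^sup>2 - 4 * a * c k))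
          + 2 * n * a * \<Phi> t * deriv \<Phi> t) else 0)"
proof -
  let ?g = "\<lambda>y. (1 / (\<Phi> (s y))\<^sup>2) *\<^sub>R pseudo_euclidean \<epsilon>"
  define Q where "Q = 4 * a * t + (\<Sum>k\<in>UNIV. \<epsilon> k * (b k)\<^sup>2 - 4 * a * c k)"
  have Q: "(\<Sum>k\<in>UNIV. \<epsilon> k * (\<sigma> k)\<^sup>2) = Q"
    unfolding \<sigma>_def Q_def t_def by (rule sum_grad_invariant_sq[OF eps])
  have sU: "s y \<in> U" if "y \<in> \<Omega>" for y
    using \<Omega>(3) that by blast
  have t: "t \<in> U" "s x = t" "\<Phi> t \<noteq> 0" "H t \<noteq> 0"
    using sU[OF \<Omega>(2)] nonzero[OF \<Omega>(2)] by (simp_all add: t_def s_def)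
  have d1: "partial k (\<lambda>y. F (s y)) x = deriv F t * \<sigma> k" if "smooth_on U F" for F k
    unfolding s_def \<sigma>_def using smooth_on_imp_has_real_derivative(1)[OF that t(1)]
    by (intro partial_comp_basic_invariant) (simp add: t_def)
  have d2: "partial k (partial l (\<lambda>y. F (s y))) x =
      deriv (deriv F) t * \<sigma> k * \<sigma> l + (if k = l then 2 * a * \<epsilon> l * deriv F t else 0)"
    if "smooth_on U F" for F k l
    using partial_partial_comp_basic_invariant[OF that \<Omega>(1,2) \<Omega>(3)[unfolded s_def]]
    by (simp add: s_def t_def \<sigma>_def)
  have diff: "(\<lambda>y. \<Phi> (s y)) differentiable (at y)" if "y \<in> \<Omega>" for y
    unfolding s_def differentiable_def
    using has_derivative_comp_basic_invariant
      smooth_on_imp_has_real_derivative(1)[OF smooth(2) sU[OF that]] s_def by blast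
  have diff2: "partial k (\<lambda>y. \<Phi> (s y)) differentiable (at x)" for k
    unfolding s_def differentiable_def
    using has_derivative_partial_comp_basic_invariant[OF smooth(2) \<Omega>(1,2) \<Omega>(3)[unfolded s_def]] by blast
  have "(\<Sum>k\<in>UNIV. \<epsilon> k * partial k (partial k (\<lambda>y. \<Phi> (s y))) x) =
      deriv (deriv \<Phi>) t * Q + 2 * n * a * deriv \<Phi> t"
  proof -
    \<comment> \<open>Each diagonal entry contributes \<open>2 * a * deriv \<Phi> t\<close> because
      the two signs cancel; over all \<open>k\<close> this yields the factor
      \<open>2 * n * a\<close>.\<close>
    have "\<epsilon> k * partial k (partial k (\<lambda>y. \<Phi> (s y))) x =
        deriv (deriv \<Phi>) t * (\<epsilon> k * (\<sigma> k)\<^sup>2) + 2 * a * deriv \<Phi> t" for k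
      using eps[of k] by (auto simp: d2 smooth power2_eq_square)
    then show ?thesis
      unfolding Q[symmetric] n_def by (simp add: sum.distrib flip: sum_distrib_left)
  qed
  moreover have "(\<Sum>k\<in>UNIV. \<epsilon> k * (partial k (\<lambda>y. \<Phi> (s y)) x)\<^sup>2) = (deriv \<Phi> t)\<^sup>2 * Q"
    unfolding Q[symmetric] by (simp add: d1 smooth power_mult_distrib sum_distrib_left mult_ac)
  ultimately have ric: "(\<Phi> t)\<^sup>2 * ricci ?g x $ i $ j =
      (n - 2) * \<Phi> t * (deriv (deriv \<Phi>) t * \<sigma> i * \<sigma> j + (if i = j then 2 * a * \<epsilon> j * deriv \<Phi> t else 0))
      + (if i = j then \<epsilon> i * (\<Phi> t * (deriv (deriv \<Phi>) t * Q + 2 * n * a * deriv \<Phi> t)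
          - (n - 1) * ((deriv \<Phi> t)\<^sup>2 * Q)) else 0)"
    using ricci_conformal[where \<epsilon> = \<epsilon> and f = "\<lambda>y. \<Phi> (s y)" and j = i and k = j, OF eps \<Omega>(1,2)] diff nonzero diff2
    by (simp add: d2 smooth t(2) n_def mult_ac)
  have grad: "(\<Sum>k\<in>UNIV. \<epsilon> k * partial k (\<lambda>y. \<Phi> (s y)) x * partial k (\<lambda>y. H (s y)) x) =
      deriv \<Phi> t * deriv H t * Q"
    unfolding Q[symmetric] by (simp add: d1 smooth power2_eq_square sum_distrib_left mult_ac)
  have hes: "hess ?g (\<lambda>y. H (s y)) x $ i $ j =
      deriv (deriv H) t * \<sigma> i * \<sigma> j + (if i = j then 2 * a * \<epsilon> j * deriv H t else 0)
      + 2 * deriv \<Phi> t * deriv H t * \<sigma> i * \<sigma> j / \<Phi> t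
      - (if i = j then \<epsilon> i * (deriv \<Phi> t * deriv H t * Q) / \<Phi> t else 0)"
    using hess_conformal[where \<epsilon> = \<epsilon> and f = "\<lambda>y. \<Phi> (s y)" and u = "\<lambda>y. H (s y)" and i = i and j = j,
        OF eps diff[OF \<Omega>(2)] nonzero(2)[OF \<Omega>(2)]]
    unfolding grad by (simp add: d1 d2 smooth t(2) mult_ac)
  show ?thesis
    unfolding right_diff_distrib ric hes Q_def[symmetric] using t(3,4)
    by (cases "i = j") (simp_all add: field_simps power2_eq_square)
qed

section \<open>Separating the rank-one part from the metric part\<close>

text \<open>For a second index \<open>j\<close>, the off-diagonal entry forces \<open>K\<close>,
  \<open>\<sigma> i\<close> or \<open>\<sigma> j\<close> to vanish, and in each case a diagonal
  entry gives \<open>D = 0\<close>. The diagonal entry at \<open>i\<close> then gives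
  \<open>K = 0\<close> if \<open>\<sigma> i\<close> is nonzero.\<close>

lemma rank_one_eq_diagonal:
  fixes \<sigma> \<epsilon> :: "'n::finite \<Rightarrow> real"
  assumes "CARD('n) \<ge> 2" "\<And>k. \<epsilon> k = 1 \<or> \<epsilon> k = -1"
    and eq: "\<And>i j. K * \<sigma> i * \<sigma> j = (if i = j then \<epsilon> i * D else 0)"
  shows "D = 0" "\<sigma> i \<noteq> 0 \<Longrightarrow> K = 0"
proof -
  have eps: "\<epsilon> k \<noteq> 0" for k
    using assms(2)[of k] by auto
  obtain j where "j \<noteq> i"
    using assms(1) by (metis card_1_singleton_iff UNIV_I UNIV_eq_I One_nat_def Suc_1 insertCI
        not_less_eq_eq order_refl singletonD)
  then have "K * \<sigma> i * \<sigma> j = 0" "K * \<sigma> i * \<sigma> i = \<epsilon> i * D" "K * \<sigma> j * \<sigma> j = \<epsilon> j * D"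
    using eq[of i j] eq[of i i] eq[of j j] by auto
  then show "D = 0"
    using eps by auto
  then show "K = 0" if "\<sigma> i \<noteq> 0"
    using that eq[of i i] by simp
qed

section \<open>Equivalence with the differential equation\<close>

theorem theorem4:
  fixes \<epsilon> b c :: "'n::finite \<Rightarrow> real"
    and a m S n :: real
    and \<Omega> :: "(real^'n) set"
    and U :: "real set"
    and P h \<phi> lam H \<Phi> L :: "real \<Rightarrow> real"
    and s \<xi> :: "real^'n \<Rightarrow> real"
  assumes dim: "CARD('n) \<ge> 2" "n = real CARD('n)"
    and eps: "\<And>k. \<epsilon> k = 1 \<or> \<epsilon> k = -1"
    and m: "m > 0"
    and \<Omega>: "open \<Omega>"
    and s: "s = basic_invariant a \<epsilon> b c"
    and S: "S = (\<Sum>k\<in>UNIV. \<epsilon> k * (b k)\<^sup>2 - 4 * a * c k)"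
    and U: "open U" "s ` \<Omega> \<subseteq> U"
    and P: "P C1_differentiable_on U"
    and \<xi>: "\<xi> = P \<circ> s"
    and comp: "H = h \<circ> P" "\<Phi> = \<phi> \<circ> P" "L = lam \<circ> P"
    and smooth: "smooth_on U H" "smooth_on U \<Phi>" "smooth_on U L"
    and nonconst: "\<not> (h \<circ> \<xi>) constant_on \<Omega>" "\<not> (\<phi> \<circ> \<xi>) constant_on \<Omega>"
      "\<not> (lam \<circ> \<xi>) constant_on \<Omega>"
    and nonzero: "\<And>x. x \<in> \<Omega> \<Longrightarrow> h (\<xi> x) \<noteq> 0" "\<And>x. x \<in> \<Omega> \<Longrightarrow> \<phi> (\<xi> x) \<noteq> 0"
  shows "generalized_quasi_Einstein \<Omega> (\<lambda>x. (1 / (\<phi> (\<xi> x))\<^sup>2) *\<^sub>R pseudo_euclidean \<epsilon>) m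
           (\<lambda>x. h (\<xi> x)) (\<lambda>x. lam (\<xi> x))
     \<longleftrightarrow>
     (\<forall>t \<in> s ` \<Omega>.
        (n - 2) * H t * deriv (deriv \<Phi>) t - m * \<Phi> t * deriv (deriv H) t
          - 2 * m * deriv \<Phi> t * deriv H t = 0 \<and>
        L t =
          2 * a * \<Phi> t * ((n - 2) * deriv \<Phi> t - m * \<Phi> t * (deriv H t / H t))
          + (\<Phi> t * deriv (deriv \<Phi>) t - (n - 1) * (deriv \<Phi> t)\<^sup>2
             + m * \<Phi> t * deriv \<Phi> t * (deriv H t / H t)) * (4 * a * t + S)
          + 2 * n * a * \<Phi> t * deriv \<Phi> t)"
proof -
  let ?\<sigma> = "\<lambda>i. grad_invariant a \<epsilon> b i"
  define E where "E t = (n - 2) * H t * deriv (deriv \<Phi>) t - m * \<Phi> t * deriv (deriv H) t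
          - 2 * m * deriv \<Phi> t * deriv H t" for t
  define R where "R t = 2 * a * \<Phi> t * ((n - 2) * deriv \<Phi> t - m * \<Phi> t * (deriv H t / H t))
          + (\<Phi> t * deriv (deriv \<Phi>) t - (n - 1) * (deriv \<Phi> t)\<^sup>2
             + m * \<Phi> t * deriv \<Phi> t * (deriv H t / H t)) * (4 * a * t + S)
          + 2 * n * a * \<Phi> t * deriv \<Phi> t" for t
  define G where "G y = (1 / (\<Phi> (s y))\<^sup>2) *\<^sub>R pseudo_euclidean \<epsilon>" for y :: "real^'n"
  have nz: "H (s x) \<noteq> 0" "\<Phi> (s x) \<noteq> 0" if "x \<in> \<Omega>" for x
    using nonzero[OF that] by (simp_all add: comp \<xi>)
  have tensor: "(\<Phi> (s x))\<^sup>2 * (ricci G x $ i $ j - m / H (s x) * hess G (\<lambda>y. H (s y)) x $ i $ j) =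
      \<Phi> (s x) / H (s x) * E (s x) * ?\<sigma> i x * ?\<sigma> j x + (if i = j then \<epsilon> i * R (s x) else 0)"
    if "x \<in> \<Omega>" for x i j
    using quasi_Einstein_tensor_comp_basic_invariant[OF eps \<Omega> that U(2)[unfolded s] smooth(1,2)] nz
    unfolding E_def R_def G_def [abs_def] dim(2) S s by blast
  have pointwise: "ricci G x - (m / H (s x)) *\<^sub>R hess G (\<lambda>y. H (s y)) x = L (s x) *\<^sub>R G x \<longleftrightarrow>
      (\<forall>i j. \<Phi> (s x) / H (s x) * E (s x) * ?\<sigma> i x * ?\<sigma> j x =
        (if i = j then \<epsilon> i * (L (s x) - R (s x)) else 0))" if "x \<in> \<Omega>" for x
  proof -
    have "ricci G x $ i $ j - m / H (s x) * hess G (\<lambda>y. H (s y)) x $ i $ j = L (s x) * G x $ i $ j \<longleftrightarrow>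
        \<Phi> (s x) / H (s x) * E (s x) * ?\<sigma> i x * ?\<sigma> j x =
        (if i = j then \<epsilon> i * (L (s x) - R (s x)) else 0)" (is "?l = ?r \<longleftrightarrow> _") for i j
    proof -
      \<comment> \<open>Scaling by the nonzero \<open>(\<Phi> (s x))\<^sup>2\<close> turns
        \<open>G x\<close> into the flat metric and makes \<open>tensor\<close> applicable.\<close>
      have "?l = ?r \<longleftrightarrow> (\<Phi> (s x))\<^sup>2 * ?l = (\<Phi> (s x))\<^sup>2 * ?r"
        using nz[OF that] by simp
      moreover have "(\<Phi> (s x))\<^sup>2 * ?r = (if i = j then \<epsilon> i * L (s x) else 0)"
        using nz[OF that] by (simp add: G_def pseudo_euclidean_def)
      ultimately show ?thesis
        unfolding tensor[OF that] by (auto simp: right_diff_distrib)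
    qed
    then show ?thesis
      by (simp add: vec_eq_iff)
  qed
  have "(\<forall>x\<in>\<Omega>. ricci G x - (m / H (s x)) *\<^sub>R hess G (\<lambda>y. H (s y)) x = L (s x) *\<^sub>R G x) \<longleftrightarrow>
      (\<forall>x\<in>\<Omega>. E (s x) = 0 \<and> L (s x) = R (s x))" (is "?QE \<longleftrightarrow> ?ODE")
  proof
    assume ?ODE
    then show ?QE
      using pointwise by simp
  next
    assume QE: ?QE
    \<comment> \<open>The formula for \<lambda> follows at every point, critical points of
      \<open>s\<close> included.\<close>
    have L: "L (s x) = R (s x)" if "x \<in> \<Omega>" for x
      using rank_one_eq_diagonal(1)[OF dim(1) eps] pointwise[OF that] QE that by fastforce
    have reg: "E (s x) = 0" if "x \<in> \<Omega>" "?\<sigma> i x \<noteq> 0" for x i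
    proof -
      have "\<Phi> (s x) / H (s x) * E (s x) = 0"
        by (rule rank_one_eq_diagonal(2)[OF dim(1) eps, where \<sigma> = "\<lambda>i. ?\<sigma> i x"])
          (use pointwise[of x] QE that in auto)
      then show ?thesis
        using nz[OF that(1)] by simp
    qed
    have "E (s x) = 0" if x: "x \<in> \<Omega>" for x
    proof (cases "\<exists>i. ?\<sigma> i x \<noteq> 0")
      case True
      then show ?thesis
        using reg x by blast
    next
      case False
      then have crit: "2 * a * \<epsilon> i * x $ i + b i = 0" for i
        by (simp add: grad_invariant_def)
      \<comment> \<open>If \<open>a\<close> were zero, a critical point would force every
        \<open>b i\<close> to vanish, so \<open>s\<close> and with it \<open>h \<circ> \<xi>\<close>
        would be constant.\<close>
      have "a \<noteq> 0"
      proof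
        assume "a = 0"
        then have "s y = s x" for y
          using crit by (simp add: s basic_invariant_def)
        then have "(h \<circ> \<xi>) constant_on \<Omega>"
          by (metis \<xi> comp_apply constant_on_def)
        then show False
          using nonconst(1) by blast
      qed
      \<comment> \<open>Hence the critical point is isolated, and the equation extends to it by continuity.\<close>
      have "E (s y) = 0" if "y \<in> \<Omega>" "y \<noteq> x" for y
      proof -
        obtain i where "y $ i \<noteq> x $ i"
          using \<open>y \<noteq> x\<close> by (auto simp: vec_eq_iff)
        moreover have "?\<sigma> i y = 2 * a * \<epsilon> i * (y $ i - x $ i)"
          using crit[of i] by (simp add: grad_invariant_def algebra_simps)
        ultimately show ?thesis
          using reg[OF that(1), of i] \<open>a \<noteq> 0\<close> eps[of i] by auto
      qed
      then have "eventually (\<lambda>y. E (s y) = 0) (at x)"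
        using \<Omega> x unfolding eventually_at_topological by blast
      then have "((\<lambda>y. E (s y)) \<longlongrightarrow> 0) (at x)"
        by (rule tendsto_eventually)
      moreover have "isCont E (s x)"
      proof -
        have "s x \<in> U"
          using U x by blast
        note * = smooth_on_imp_has_real_derivative[OF smooth(1) this]
          smooth_on_imp_has_real_derivative[OF smooth(2) this]
        show ?thesis
          unfolding E_def [abs_def] using *(1,2,4,5)[THEN DERIV_isCont] *(3,6)
          by (intro continuous_intros) auto
      qed
      moreover have "isCont s x"
        unfolding s using has_derivative_basic_invariant has_derivative_continuous by blast
      \<comment> \<open>\<open>E (s y)\<close> tends both to \<open>0\<close> and to
        \<open>E (s x)\<close> as \<open>y\<close> approaches \<open>x\<close>. Limits at
        \<open>x\<close> are unique because the space has no isolated points.\<close>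
      ultimately show ?thesis
        using isCont_o2[of x s E] trivial_limit_at LIM_unique isCont_def by metis
    qed
    then show ?ODE
      using L by blast
  qed
  then show ?thesis
    \<comment> \<open>By \<open>comp\<close>, composing \<open>h\<close>, \<phi> and
      \<open>lam\<close> with \<xi> is the same as composing \<open>H\<close>, \<Phi> and
      \<open>L\<close> with \<open>s\<close>.\<close>
    unfolding generalized_quasi_Einstein_def E_def R_def G_def [abs_def]
    by (simp add: comp \<xi>)
qed

end
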